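(* Let $(\mathcal{A},\circ)$ be a graded twisted Heisenberg-Virasoro left-symmetric algebra (with any admissible parameters $\alpha,\beta,\epsilon$). Then every biderivation $f$ of $\mathcal{A}$ is trivial, i.e. $f=0$.
   Context: A graded twisted Heisenberg-Virasoro left-symmetric algebra is an algebra $(\mathcal{A},\circ)$ with $\mathbb{C}$-basis $\{L_n,I_n,C_1,C_2,C_3\mid n\in\mathbb{Z}\}$ and bilinear product satisfying $$L_m\circ L_n=\frac{-n(1+\epsilon n)}{1+\epsilon(m+n)}L_{m+n}+\frac{C_1}{24}\bigl(m^3-m+(\epsilon-\epsilon^{-1})m^2\bigr)\delta_{m,-n},$$ $$L_m\circ I_n=-n\bigl(1+(1-\epsilon n)\alpha\,\delta_{m,-n}\bigr)I_{m+n}+\bigl(m^2-m+(\epsilon m^2+m)\beta\bigr)C_2\,\delta_{m,-n},$$ $$I_m\circ L_n=n(1+\epsilon n)\alpha\,\delta_{m,-n}I_{m+n}+n(1+\epsilon n)\beta\,C_2\,\delta_{m,-n},$$ $$I_m\circ I_n=\frac{n\,C_3}{2}\delta_{m,-n},\qquad C_i\circ C_j=C_i\circ L_m=L_m\circ C_i=C_i\circ I_m=I_m\circ C_i=0$$ for all $m,n\in\mathbb{Z}$ and $i,j\in\{1,2,3\}$, where $\alpha,\beta,\epsilon\in\mathbb{C}$ are such that either $\mathrm{Re}\,\epsilon>0$ and $\epsilon^{-1}\notin\mathbb{Z}$, or $\mathrm{Re}\,\epsilon=0$ and $\mathrm{Im}\,\epsilon>0$. A biderivation of an algebra $(\mathcal{A},\circ)$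 is a bilinear map $f:\mathcal{A}\times\mathcal{A}\to\mathcal{A}$ with $f(x\circ y,z)=x\circ f(y,z)+f(x,z)\circ y$ and $f(x,y\circ z)=f(x,y)\circ z+y\circ f(x,z)$ for all $x,y,z\in\mathcal{A}$. *)

theory Defs
  imports Complex_Main
begin

definition complex_bilinear ::
    "(complex \<Rightarrow> 'a \<Rightarrow> 'a) \<Rightarrow> ('a \<Rightarrow> 'a \<Rightarrow> 'a::ab_group_add) \<Rightarrow> bool" where
  "complex_bilinear scale f \<longleftrightarrow>
     (\<forall>x. Vector_Spaces.linear scale scale (\<lambda>y. f x y)) \<and>
     (\<forall>y. Vector_Spaces.linear scale scale (\<lambda>x. f x y))"

text \<open>
  A complex algebra, not assumed associative, commutative or unital. Its carrier is a whole
  type. The scalar multiplication is a parameter because the library has no class of complex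
  vector spaces without a topology.
\<close>

locale complex_algebra = vector_space scale
  for scale :: "complex \<Rightarrow> 'a::ab_group_add \<Rightarrow> 'a" (infixr \<open>*s\<close> 75) +
  fixes mul :: "'a \<Rightarrow> 'a \<Rightarrow> 'a" (infixl \<open>\<star>\<close> 70)
  assumes bilinear_mul: "complex_bilinear scale mul"
begin

definition biderivation :: "('a \<Rightarrow> 'a \<Rightarrow> 'a) \<Rightarrow> bool" where
  "biderivation f \<longleftrightarrow>
     complex_bilinear scale f \<and>
     (\<forall>x y z. f (x \<star> y) z = x \<star> f y z + f x z \<star> y) \<and>
     (\<forall>x y z. f x (y \<star> z) = f x y \<star> z + y \<star> f x z)"

end

definition admissible :: "complex \<Rightarrow> bool" where
  "admissible \<epsilon> \<longleftrightarrow> (Re \<epsilon> > 0 \<and> inverse \<epsilon> \<notin> \<int>) \<or> (Re \<epsilon> = 0 \<and> Im \<epsilon> > 0)"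

datatype hv_label = Lab_L int | Lab_I int | Lab_C1 | Lab_C2 | Lab_C3

primrec hv_family ::
    "(int \<Rightarrow> 'a) \<Rightarrow> (int \<Rightarrow> 'a) \<Rightarrow> 'a \<Rightarrow> 'a \<Rightarrow> 'a \<Rightarrow> hv_label \<Rightarrow> 'a" where
  "hv_family L I C1 C2 C3 (Lab_L n) = L n"
| "hv_family L I C1 C2 C3 (Lab_I n) = I n"
| "hv_family L I C1 C2 C3 Lab_C1 = C1"
| "hv_family L I C1 C2 C3 Lab_C2 = C2"
| "hv_family L I C1 C2 C3 Lab_C3 = C3"

text \<open>
  The elements \<open>L n\<close>, \<open>I n\<close>, \<open>C1\<close>, \<open>C2\<close>, \<open>C3\<close> form a basis as an indexed family, so
  injectivity of the family is part of the requirement; \<open>of_bool (m = - n)\<close> is the Kronecker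
  delta of \<open>m\<close> and \<open>- n\<close>. The left-symmetry identity is not listed as an axiom, since the
  structure constants are fully prescribed by the products below. Admissibility of \<open>\<epsilon>\<close> makes
  \<open>\<epsilon>\<close> and all the denominators \<open>1 + \<epsilon> (m + n)\<close> nonzero.
\<close>

locale graded_HV_left_symmetric_algebra = complex_algebra scale mul
  for scale :: "complex \<Rightarrow> 'a::ab_group_add \<Rightarrow> 'a" (infixr \<open>*s\<close> 75)
    and mul :: "'a \<Rightarrow> 'a \<Rightarrow> 'a" (infixl \<open>\<star>\<close> 70) +
  fixes L I :: "int \<Rightarrow> 'a"
    and C1 C2 C3 :: 'a
    and \<alpha> \<beta> \<epsilon> :: complex
  assumes admissible: "admissible \<epsilon>"
    and basis_inj: "inj (hv_family L I C1 C2 C3)"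
    and basis_independent: "\<not> dependent (range (hv_family L I C1 C2 C3))"
    and basis_span: "span (range (hv_family L I C1 C2 C3)) = UNIV"
    and L_L: "\<And>m n. L m \<star> L n =
          (- of_int n * (1 + \<epsilon> * of_int n) / (1 + \<epsilon> * of_int (m + n))) *s L (m + n)
        + ((of_int m ^ 3 - of_int m + (\<epsilon> - inverse \<epsilon>) * of_int m ^ 2) / 24
            * of_bool (m = - n)) *s C1"
    and L_I: "\<And>m n. L m \<star> I n =
          (- of_int n * (1 + (1 - \<epsilon> * of_int n) * \<alpha> * of_bool (m = - n))) *s I (m + n)
        + ((of_int m ^ 2 - of_int m + (\<epsilon> * of_int m ^ 2 + of_int m) * \<beta>)
            * of_bool (m = - n)) *s C2"
    and I_L: "\<And>m n. I m \<star> L n =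
          (of_int n * (1 + \<epsilon> * of_int n) * \<alpha> * of_bool (m = - n)) *s I (m + n)
        + (of_int n * (1 + \<epsilon> * of_int n) * \<beta> * of_bool (m = - n)) *s C2"
    and I_I: "\<And>m n. I m \<star> I n = (of_int n / 2 * of_bool (m = - n)) *s C3"
    and C_C: "\<And>c d. c \<in> {C1, C2, C3} \<Longrightarrow> d \<in> {C1, C2, C3} \<Longrightarrow> c \<star> d = 0"
    and C_L: "\<And>c m. c \<in> {C1, C2, C3} \<Longrightarrow> c \<star> L m = 0"
    and L_C: "\<And>c m. c \<in> {C1, C2, C3} \<Longrightarrow> L m \<star> c = 0"
    and C_I: "\<And>c m. c \<in> {C1, C2, C3} \<Longrightarrow> c \<star> I m = 0"
    and I_C: "\<And>c m. c \<in> {C1, C2, C3} \<Longrightarrow> I m \<star> c = 0"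

end

theory Submission
  imports Defs
begin

text \<open>
  Left multiplication by \<open>L 0\<close> is diagonal on the basis: it multiplies \<open>L n\<close> and \<open>I n\<close> by \<open>- n\<close>
  and kills \<open>C1\<close>, \<open>C2\<close>, \<open>C3\<close>. So it is minus the degree operator for the grading in which
  \<open>L n\<close> and \<open>I n\<close> have degree \<open>n\<close> and the \<open>C\<close>s have degree \<open>0\<close>. Right multiplication by \<open>L 0\<close>,
  on the other hand, is zero.

  For a derivation \<open>D\<close> the second fact gives \<open>L 0 \<star> D (L 0) = 0\<close>, so \<open>D (L 0)\<close> has degree \<open>0\<close>, and
  left multiplication by an element of degree \<open>0\<close> is a scalar multiple of left multiplication by
  \<open>L 0\<close>. That scalar vanishes because a diagonal operator has no generalised eigenvectors beyond
  its eigenvectors. Hence \<open>D\<close> commutes with left multiplication by \<open>L 0\<close>, that is, every derivation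
  preserves the degree (\<open>derivation_preserves_degree\<close>).

  Now let \<open>f\<close> be a biderivation. For homogeneous \<open>x\<close> and \<open>y\<close> the value \<open>f x y\<close> has the degree of
  \<open>y\<close>, because \<open>f x\<close> is a derivation, and the degree of \<open>x\<close>, because \<open>\<lambda>x. f x y\<close> is one. So it
  is zero when these degrees differ: the derivation \<open>f x\<close> kills every homogeneous element whose
  degree is not that of \<open>x\<close>. The remaining component of the algebra consists of linear
  combinations of products of elements of other degrees, so \<open>f x\<close> kills it as well
  (\<open>derivation_eq_0_if_concentrated\<close>).
\<close>

section \<open>Diagonal operators\<close>

lemma (in vector_space) representation_diagonal:
  fixes e :: "'i \<Rightarrow> 'b" and \<mu> :: "'i \<Rightarrow> 'a"
  assumes inj: "inj e" and indep: "\<not> dependent (range e)" and span: "span (range e) = UNIV"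
    and lin: "Vector_Spaces.linear scale scale T" and diag: "\<And>i. T (e i) = scale (\<mu> i) (e i)"
  shows "representation (range e) (T v) (e i) = \<mu> i * representation (range e) v (e i)"
proof -
  interpret T: Vector_Spaces.linear scale scale T by (fact lin)
  note rep = representation_add[OF indep] representation_scale[OF indep] representation_zero
  have "v \<in> span (range e)" using span by simp
  then show ?thesis
  proof (induction rule: span_induct_alt)
    case base
    then show ?case by (simp add: T.zero rep)
  next
    case (step c x y)
    then obtain j where x: "x = e j" by auto
    have "representation (range e) (e j) (e i) = (if j = i then 1 else 0)"
      using inj by (auto simp: representation_basis[OF indep] inj_eq)
    then show ?case
      using step by (auto simp: x T.add T.scale diag rep span algebra_simps)
  qed
qed

lemma (in vector_space) kernel_diagonal:
  fixes e :: "'i \<Rightarrow> 'b" and \<mu> :: "'i \<Rightarrow> 'a"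
  assumes inj: "inj e" and indep: "\<not> dependent (range e)" and span: "span (range e) = UNIV"
    and lin: "Vector_Spaces.linear scale scale T" and diag: "\<And>i. T (e i) = scale (\<mu> i) (e i)"
    and "T v = 0"
  shows "v \<in> span (e ` {i. \<mu> i = 0})"
proof -
  let ?r = "representation (range e) v"
  have "\<mu> i * ?r (e i) = 0" for i
    using representation_diagonal[OF inj indep span lin diag, of v i] \<open>T v = 0\<close>
    by (simp add: representation_zero)
  then have "b \<in> e ` {i. \<mu> i = 0}" if "?r b \<noteq> 0" for b
    using that representation_ne_zero[OF that] by auto
  then have "(\<Sum>b | ?r b \<noteq> 0. scale (?r b) b) \<in> span (e ` {i. \<mu> i = 0})"
    by (intro span_sum span_scale span_base) auto
  then show ?thesis
    using sum_nonzero_representation_eq[OF indep, of v] span by simp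
qed

text \<open>
  This is the absence of Jordan blocks: if \<open>T - \<mu> i\<close> maps \<open>v\<close> to a multiple of the eigenvector
  \<open>e i\<close>, which \<open>T - \<mu> i\<close> itself kills, then that multiple is zero.
\<close>

lemma (in vector_space) no_jordan_block_diagonal:
  fixes e :: "'i \<Rightarrow> 'b" and \<mu> :: "'i \<Rightarrow> 'a"
  assumes inj: "inj e" and indep: "\<not> dependent (range e)" and span: "span (range e) = UNIV"
    and lin: "Vector_Spaces.linear scale scale T" and diag: "\<And>i. T (e i) = scale (\<mu> i) (e i)"
    and "T v = scale (\<mu> i) v + scale c (e i)"
  shows "c = 0"
proof -
  note rep = representation_add[OF indep] representation_scale[OF indep]
  have "representation (range e) (T v) (e i) = \<mu> i * representation (range e) v (e i) + c"
    using assms(6) by (simp add: rep span representation_basis[OF indep])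
  then show ?thesis
    using representation_diagonal[OF inj indep span lin diag, of v i] by simp
qed

section \<open>Derivations\<close>

context complex_algebra
begin

definition derivation :: "('a \<Rightarrow> 'a) \<Rightarrow> bool" where
  "derivation D \<longleftrightarrow>
     Vector_Spaces.linear scale scale D \<and> (\<forall>x y. D (x \<star> y) = x \<star> D y + D x \<star> y)"

lemma biderivation_derivation:
  assumes "biderivation f"
  shows "derivation (f x)" and "derivation (\<lambda>y. f y x)"
  using assms by (auto simp: biderivation_def derivation_def complex_bilinear_def add.commute)

lemma linear_mul: "Vector_Spaces.linear scale scale (\<lambda>y. x \<star> y)"
  "Vector_Spaces.linear scale scale (\<lambda>x. x \<star> y)"
  using bilinear_mul by (auto simp: complex_bilinear_def)

sublocale mulL: Vector_Spaces.linear scale scale "\<lambda>y. x \<star> y" for x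
  by (rule linear_mul)

sublocale mulR: Vector_Spaces.linear scale scale "\<lambda>x. x \<star> y" for y
  by (rule linear_mul)

lemma derivation_kernel_mul:
  assumes "derivation D" "D x = 0" "D y = 0"
  shows "D (x \<star> y) = 0"
  using assms by (simp add: derivation_def mulL.zero mulR.zero)

end

section \<open>The grading\<close>

primrec hv_degree :: "hv_label \<Rightarrow> int" where
  "hv_degree (Lab_L n) = n"
| "hv_degree (Lab_I n) = n"
| "hv_degree Lab_C1 = 0"
| "hv_degree Lab_C2 = 0"
| "hv_degree Lab_C3 = 0"

lemma admissible_nonzero:
  assumes "admissible \<epsilon>"
  shows "1 + \<epsilon> * of_int n \<noteq> 0"
proof
  assume eq: "1 + \<epsilon> * of_int n = 0"
  then have "\<epsilon> * of_int (- n) = 1" by (simp add: add_eq_0_iff)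
  then have inv: "inverse \<epsilon> = of_int (- n)" by (rule inverse_unique)
  then have "inverse \<epsilon> \<in> \<int>" by simp
  with assms have "Re \<epsilon> = 0" by (simp add: admissible_def)
  with arg_cong[OF eq, of Re] show False by simp
qed

context graded_HV_left_symmetric_algebra
begin

abbreviation e :: "hv_label \<Rightarrow> 'a" where
  "e \<equiv> hv_family L I C1 C2 C3"

lemma linear_eq_0_if_basis:
  assumes "Vector_Spaces.linear scale scale T" "\<And>i. T (e i) = 0"
  shows "T x = 0"
proof -
  interpret T: Vector_Spaces.linear scale scale T by (fact assms(1))
  show ?thesis
    using T.eq_0_on_span[of "range e" x] assms(2) basis_span by auto
qed

lemma L0_mul_basis: "L 0 \<star> e i = (- of_int (hv_degree i)) *s e i"
proof (cases i)
  case (Lab_L n)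
  then show ?thesis
    using admissible_nonzero[OF admissible, of n] by (simp add: L_L)
qed (simp_all add: L_I L_C)

lemma mul_L0: "x \<star> L 0 = 0"
proof (rule linear_eq_0_if_basis[OF linear_mul(2)])
  show "e i \<star> L 0 = 0" for i by (cases i) (auto simp: L_L I_L C_L)
qed

lemma I0_mul: "I 0 \<star> x = 0"
proof (rule linear_eq_0_if_basis[OF linear_mul(1)])
  show "I 0 \<star> e i = 0" for i by (cases i) (auto simp: I_L I_I I_C)
qed

lemma C_mul:
  assumes "c \<in> {C1, C2, C3}"
  shows "c \<star> x = 0"
proof (rule linear_eq_0_if_basis[OF linear_mul(1)])
  show "c \<star> e i = 0" for i
    using assms by (cases i) (simp_all add: C_L C_I C_C)
qed

text \<open>
  Among the basis elements of degree \<open>0\<close> all but \<open>L 0\<close> multiply everything to zero from the left.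
\<close>

lemma degree_0_mul:
  assumes "L 0 \<star> v = 0"
  obtains a where "\<And>x. v \<star> x = a *s (L 0 \<star> x)"
proof -
  have "v \<in> span (e ` {i. - complex_of_int (hv_degree i) = 0})"
    using kernel_diagonal[OF basis_inj basis_independent basis_span linear_mul(1) L0_mul_basis assms] .
  then have "\<exists>a. \<forall>x. v \<star> x = a *s (L 0 \<star> x)"
  proof (induction rule: span_induct_alt)
    case base
    show ?case by (rule exI[of _ 0]) (simp add: mulR.zero)
  next
    case (step c b w)
    then obtain a where a: "\<And>x. w \<star> x = a *s (L 0 \<star> x)" by blast
    from step obtain i where i: "b = e i" "hv_degree i = 0" by auto
    have "\<exists>a'. \<forall>x. b \<star> x = a' *s (L 0 \<star> x)"
    proof (cases i)
      case (Lab_L n)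
      then show ?thesis using i by (auto intro: exI[of _ 1])
    qed (use i in \<open>auto simp: I0_mul C_mul intro: exI[of _ 0]\<close>)
    then obtain a' where "\<And>x. b \<star> x = a' *s (L 0 \<star> x)" by blast
    with a show ?case
      by (intro exI[of _ "c * a' + a"]) (simp add: mulR.add mulR.scale scale_left_distrib)
  qed
  with that show thesis by blast
qed

section \<open>Derivations preserve the degree\<close>

lemma derivation_preserves_degree:
  assumes "derivation D"
  shows "L 0 \<star> D (e i) = (- of_int (hv_degree i)) *s D (e i)"
proof -
  interpret D: Vector_Spaces.linear scale scale D
    using assms by (simp add: derivation_def)
  have D: "D (x \<star> y) = x \<star> D y + D x \<star> y" for x y
    using assms by (simp add: derivation_def)
  have "L 0 \<star> D (L 0) = 0"
    using D[of "L 0" "L 0"] by (simp add: mul_L0 D.zero)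
  then obtain a where a: "\<And>x. D (L 0) \<star> x = a *s (L 0 \<star> x)"
    using degree_0_mul[of "D (L 0)"] by blast
  have shift: "L 0 \<star> D (e j) = (- of_int (hv_degree j)) *s D (e j) + (a * of_int (hv_degree j)) *s e j" for j
    using D[of "L 0" "e j"] by (simp add: L0_mul_basis a D.scale D.neg mulL.neg algebra_simps)
  \<comment> \<open>Any basis element of nonzero degree shows that \<open>a = 0\<close>.\<close>
  have "a * of_int (hv_degree (Lab_L 1)) = 0"
    by (rule no_jordan_block_diagonal[OF basis_inj basis_independent basis_span linear_mul(1)
          L0_mul_basis shift])
  then show ?thesis using shift[of i] by simp
qed

lemma biderivation_eq_0_if_degree_neq:
  assumes "biderivation f" "hv_degree i \<noteq> hv_degree j"
  shows "f (e i) (e j) = 0"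
proof -
  have "(- of_int (hv_degree i)) *s f (e i) (e j) = (- of_int (hv_degree j)) *s f (e i) (e j)"
    using derivation_preserves_degree[OF biderivation_derivation(1)[OF assms(1), of "e i"], of j]
      derivation_preserves_degree[OF biderivation_derivation(2)[OF assms(1), of "e j"], of i]
    by simp
  then show ?thesis using assms(2) by simp
qed

section \<open>Each component is generated by the others\<close>

text \<open>
  Elements of degree \<open>m \<noteq> 0\<close> are, up to a nonzero factor, products of elements of degrees \<open>2 m\<close>
  and \<open>- m\<close>. In degree \<open>0\<close>, commutators of elements of degrees \<open>m\<close> and \<open>- m\<close> isolate \<open>L 0\<close>, \<open>I 0\<close> and
  then \<open>C2\<close>: they are free of the terms in \<open>\<alpha>\<close> and \<open>\<beta>\<close>, and for \<open>m = 1\<close> also of \<open>C1\<close> and \<open>C2\<close>. Once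
  \<open>L 0\<close> is available, \<open>L 1 \<star> L (- 1)\<close> yields \<open>C1\<close>, because admissibility excludes \<open>\<epsilon>\<^sup>2 = 1\<close>.
\<close>

lemma derivation_eq_0_if_concentrated:
  assumes der: "derivation D" and zero: "\<And>i. hv_degree i \<noteq> m \<Longrightarrow> D (e i) = 0"
  shows "D x = 0"
proof -
  have lin: "Vector_Spaces.linear scale scale D"
    using der by (simp add: derivation_def)
  interpret D: Vector_Spaces.linear scale scale D by (fact lin)
  have L: "D (L n) = 0" if "n \<noteq> m" for n using zero[of "Lab_L n"] that by simp
  have I: "D (I n) = 0" if "n \<noteq> m" for n using zero[of "Lab_I n"] that by simp
  note ker = derivation_kernel_mul[OF der]
  note nz = admissible_nonzero[OF admissible]
  have "D (e i) = 0" if "hv_degree i = m" for i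
  proof (cases "m = 0")
    case False
    have "D (L (2 * m) \<star> L (- m)) = 0" "D (L (2 * m) \<star> I (- m)) = 0"
      using False by (auto intro!: ker L I)
    then have "D (L m) = 0" "D (I m) = 0"
      using False nz[of m] nz[of "- m"] by (simp_all add: L_L L_I D.scale D.neg)
    with that False show ?thesis by (cases i) auto
  next
    case True
    have "D (L 1 \<star> L (- 1) - L (- 1) \<star> L 1) = 0"
      by (simp add: D.diff ker L True)
    moreover have "L 1 \<star> L (- 1) - L (- 1) \<star> L 1 = 2 *s L 0"
      using scale_left_distrib[of 1 1 "L 0"] by (simp add: L_L algebra_simps)
    ultimately have L0: "D (L 0) = 0" by (simp add: D.scale)
    have "D (L 1 \<star> L (- 1)) = 0"
      by (simp add: ker L True)
    then have "((\<epsilon> - inverse \<epsilon>) / 24) *s D C1 = 0"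
      by (simp add: L_L D.add D.scale L0)
    moreover have "\<epsilon> - inverse \<epsilon> \<noteq> 0"
    proof
      assume "\<epsilon> - inverse \<epsilon> = 0"
      moreover have "\<epsilon> \<noteq> 0" using admissible by (auto simp: admissible_def)
      ultimately have "\<epsilon> * \<epsilon> = 1" by (simp add: field_simps)
      then have "(1 + \<epsilon>) * (1 - \<epsilon>) = 0" by (simp add: algebra_simps)
      then show False using nz[of 1] nz[of "- 1"] by simp
    qed
    ultimately have C1: "D C1 = 0" by simp
    have "D (L 1 \<star> I (- 1) - I (- 1) \<star> L 1) = 0"
      by (simp add: D.diff ker L I True)
    moreover have "L 1 \<star> I (- 1) - I (- 1) \<star> L 1 = I 0"
      by (simp add: L_I I_L algebra_simps)
    ultimately have I0: "D (I 0) = 0" by simp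
    have "D (L 2 \<star> I (- 2) - I (- 2) \<star> L 2) = 0"
      by (simp add: D.diff ker L I True)
    moreover have "L 2 \<star> I (- 2) - I (- 2) \<star> L 2 = 2 *s I 0 + 2 *s C2"
      by (simp add: L_I I_L algebra_simps)
    ultimately have C2: "D C2 = 0" by (simp add: D.add D.scale I0)
    have "D (I (- 1) \<star> I 1) = 0"
      by (simp add: ker I True)
    then have C3: "D C3 = 0" by (simp add: I_I D.scale)
    show ?thesis using that L0 I0 C1 C2 C3 True by (cases i) auto
  qed
  with zero have "D (e i) = 0" for i by blast
  then show ?thesis by (rule linear_eq_0_if_basis[OF lin])
qed

lemma biderivation_eq_0:
  assumes "biderivation f"
  shows "f x y = 0"
proof (rule linear_eq_0_if_basis[where T = "\<lambda>x. f x y"])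
  show "Vector_Spaces.linear scale scale (\<lambda>x. f x y)"
    using biderivation_derivation(2)[OF assms] by (simp add: derivation_def)
  show "f (e i) y = 0" for i
  proof (rule derivation_eq_0_if_concentrated[where D = "f (e i)" and m = "hv_degree i"])
    show "derivation (f (e i))" by (rule biderivation_derivation(1)[OF assms])
    show "f (e i) (e j) = 0" if "hv_degree j \<noteq> hv_degree i" for j
      using biderivation_eq_0_if_degree_neq[OF assms, of i j] that by simp
  qed
qed

end

theorem theorem4p7:
  fixes scale :: "complex \<Rightarrow> 'a::ab_group_add \<Rightarrow> 'a"
    and mul :: "'a \<Rightarrow> 'a \<Rightarrow> 'a"
    and L I :: "int \<Rightarrow> 'a"
    and C1 C2 C3 :: 'a
    and \<alpha> \<beta> \<epsilon> :: complex
    and f :: "'a \<Rightarrow> 'a \<Rightarrow> 'a"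
  assumes "graded_HV_left_symmetric_algebra scale mul L I C1 C2 C3 \<alpha> \<beta> \<epsilon>"
    and "complex_algebra.biderivation scale mul f"
  shows "f = (\<lambda>x y. 0)"
  using graded_HV_left_symmetric_algebra.biderivation_eq_0[OF assms] by blast

end
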